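(* For every integer $s$, \[ \sum_{n=0}^\infty \frac{F_{2n+s}}{C_n}=\frac25(F_{s+4}+8F_{s+2})+(F_{s+3}\sqrt5-F_{s+1})\frac{12\pi}{25}\sqrt{\frac{\alpha^3}{\sqrt5}}, \] \[ \sum_{n=0}^\infty \frac{L_{2n+s}}{C_n}=\frac25(L_{s+4}+8L_{s+2})+(L_{s+3}\sqrt5-L_{s+1})\frac{12\pi}{25}\sqrt{\frac{\alpha^3}{\sqrt5}}. \]
   Context: $C_n=\frac{1}{n+1}\binom{2n}{n}$ are the Catalan numbers. $\alpha=\frac{1+\sqrt5}{2}$, $\beta=\frac{1-\sqrt5}{2}$. The Fibonacci and Lucas numbers are defined for all integers $n$ by $F_n=\frac{\alpha^n-\beta^n}{\alpha-\beta}$ and $L_n=\alpha^n+\beta^n$. *)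

theory Defs
  imports Complex_Main
begin

definition catalan :: "nat \<Rightarrow> real" where
  "catalan n = 1 / (real n + 1) * real ((2 * n) choose n)"

definition \<alpha> :: real where
  "\<alpha> = (1 + sqrt 5) / 2"

definition \<beta> :: real where
  "\<beta> = (1 - sqrt 5) / 2"

text \<open>
  Fibonacci and Lucas numbers at an arbitrary integer index, given by the Binet formulas
  as real numbers.
\<close>

definition fibonacci :: "int \<Rightarrow> real" where
  "fibonacci n = (\<alpha> powi n - \<beta> powi n) / (\<alpha> - \<beta>)"

definition lucas :: "int \<Rightarrow> real" where
  "lucas n = \<alpha> powi n + \<beta> powi n"

end

theory Submission
  imports Defs
begin

text \<open>
  Put \<open>H z = (\<Sum>n. z ^ n / C\<^sub>n)\<close> for \<open>\<bar>z\<bar> < 4\<close>. The recurrence of the Catalan numbers becomes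
  the linear equation \<open>z (4 - z) H' = (2 + 2 z) H - 2\<close>. Under the substitution \<open>z = 4 sin\<^sup>2 t\<close> it
  says that \<open>H (4 sin\<^sup>2 t) cos\<^sup>5 t - (sin\<^sup>2 t + 2) cos t / 2 - 3 t sin t / 2\<close> is a constant multiple
  of \<open>sin t\<close> on \<open>(0, \<pi>/2)\<close>, and comparing derivatives at \<open>0\<close> shows that the constant is zero.
  The two geometric parts of the Binet formulas have ratios \<open>\<alpha>\<^sup>2\<close> and \<open>\<beta>\<^sup>2\<close>, which correspond
  to \<open>t = 3\<pi>/10\<close> and \<open>t = \<pi>/10\<close>.
\<close>

section \<open>Recurrence of the Catalan numbers and of their reciprocals\<close>

lemma catalan_pos: "catalan n > 0"
  by (simp add: catalan_def)

lemma catalan_fact: "catalan n = fact (2 * n) / ((real n + 1) * (fact n)\<^sup>2)"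
  by (simp add: catalan_def binomial_fact power2_eq_square mult_2)

lemma catalan_Suc: "(real n + 2) * catalan (Suc n) = (4 * real n + 2) * catalan n"
proof -
  have "fact (2 * Suc n) = (2 * real n + 2) * (2 * real n + 1) * fact (2 * n)"
    by (simp add: algebra_simps)
  then have "catalan (Suc n)
      = (2 * real n + 2) * (2 * real n + 1) * fact (2 * n) / ((real n + 2) * ((real n + 1) * fact n)\<^sup>2)"
    unfolding catalan_fact by (simp add: add_ac)
  also have "\<dots> = (4 * real n + 2) * fact (2 * n) / ((real n + 2) * (real n + 1) * (fact n)\<^sup>2)"
  proof -
    have "real n + 1 \<noteq> 0" "real n + 2 \<noteq> 0" by linarith+
    then show ?thesis
      by (simp add: divide_simps power2_eq_square) algebra
  qed
  also have "(real n + 2) * \<dots> = (4 * real n + 2) * catalan n"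
  proof -
    have "real n + 2 \<noteq> 0" by linarith
    then show ?thesis by (simp add: catalan_fact)
  qed
  finally show ?thesis .
qed

text \<open>Kept free of quotients in \<open>n\<close>: multiplied by \<open>z ^ Suc n\<close> and
  summed, each side becomes a combination of \<open>H\<close>, \<open>H'\<close> and powers of
  \<open>z\<close>.\<close>

lemma inverse_catalan_Suc:
  "(4 * real n + 2) * (1 / catalan (Suc n)) = (real n + 2) * (1 / catalan n)"
  using catalan_Suc[of n] catalan_pos[of n] catalan_pos[of "Suc n"]
  by (simp add: divide_simps)

section \<open>The generating function of the reciprocals and its differential equation\<close>

lemma summable_inverse_catalan:
  fixes z :: real
  assumes "\<bar>z\<bar> < 4"
  shows "summable (\<lambda>n. 1 / catalan n * z ^ n)"
proof -
  \<comment> \<open>Consecutive terms have ratio tending to \<open>\<bar>z\<bar> / 4\<close> in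
    absolute value; \<open>c\<close> is the midpoint between this limit and 1.\<close>
  define c where "c = (\<bar>z\<bar> / 4 + 1) / 2"
  have c: "c < 1" "\<bar>z\<bar> < 4 * c" "0 < c" using assms by (auto simp: c_def)
  \<comment> \<open>Solves \<open>(n + 2) * \<bar>z\<bar> \<le> 4 * c * n\<close> for
    \<open>n\<close>, slightly more than the ratio bound asks for.\<close>
  define N where "N = nat \<lceil>2 * \<bar>z\<bar> / (4 * c - \<bar>z\<bar>)\<rceil>"
  show ?thesis
  proof (rule summable_ratio_test[OF c(1)])
    fix n assume "n \<ge> N"
    then have "2 * \<bar>z\<bar> / (4 * c - \<bar>z\<bar>) \<le> real n" unfolding N_def by linarith
    then have "2 * \<bar>z\<bar> \<le> real n * (4 * c - \<bar>z\<bar>)"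
      using c by (simp add: divide_le_eq)
    then have le: "(real n + 2) * \<bar>z\<bar> \<le> c * (4 * real n + 2)"
      using c by (simp add: algebra_simps)
    have a: "1 / catalan (Suc n) = (real n + 2) * (1 / catalan n) / (4 * real n + 2)"
    proof -
      have "4 * real n + 2 \<noteq> 0" by linarith
      then show ?thesis
        by (subst inverse_catalan_Suc[symmetric], subst nonzero_mult_div_cancel_left) auto
    qed
    have "norm (1 / catalan (Suc n) * z ^ Suc n)
        = ((real n + 2) * \<bar>z\<bar> / (4 * real n + 2)) * (1 / catalan n * \<bar>z\<bar> ^ n)"
      unfolding a using catalan_pos[of n] by (simp add: abs_mult power_abs mult_ac)
    also have "\<dots> \<le> c * (1 / catalan n * \<bar>z\<bar> ^ n)"
    proof (rule mult_right_mono)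
      show "(real n + 2) * \<bar>z\<bar> / (4 * real n + 2) \<le> c"
        using le by (subst divide_le_eq) (auto simp: add_nonneg_pos)
    qed (use catalan_pos[of n] in simp)
    also have "\<dots> = c * norm (1 / catalan n * z ^ n)"
      using catalan_pos[of n] by (simp add: abs_mult power_abs)
    finally show "norm (1 / catalan (Suc n) * z ^ Suc n) \<le> c * norm (1 / catalan n * z ^ n)" .
  qed
qed

definition inverse_catalan_gf :: "real \<Rightarrow> real" where
  "inverse_catalan_gf z = (\<Sum>n. 1 / catalan n * z ^ n)"

lemma inverse_catalan_gf_sums:
  assumes "\<bar>z\<bar> < 4"
  shows "(\<lambda>n. 1 / catalan n * z ^ n) sums inverse_catalan_gf z"
  unfolding inverse_catalan_gf_def
  by (intro summable_sums summable_inverse_catalan assms)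

lemma inverse_catalan_gf_0: "inverse_catalan_gf 0 = 1"
  using powser_zero[of "\<lambda>n. 1 / catalan n"] by (simp add: inverse_catalan_gf_def catalan_def)

lemma inverse_catalan_gf_ode:
  assumes "\<bar>z\<bar> < 4"
  obtains D where "(inverse_catalan_gf has_real_derivative D) (at z)"
    and "z * (4 - z) * D = (2 + 2 * z) * inverse_catalan_gf z - 2"
proof
  let ?a = "\<lambda>n. 1 / catalan n"
  let ?H = "inverse_catalan_gf z"
  let ?D = "\<Sum>n. diffs ?a n * z ^ n"
  show "(inverse_catalan_gf has_real_derivative ?D) (at z)"
    unfolding inverse_catalan_gf_def
    by (rule termdiffs_strong'[where K = 4])
      (use assms summable_inverse_catalan in \<open>simp_all only: real_norm_def\<close>)
  have "summable (\<lambda>n. diffs ?a n * z ^ n)"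
    by (rule termdiff_converges[where K = 4])
      (use assms summable_inverse_catalan in \<open>simp_all only: real_norm_def\<close>)
  then have "(\<lambda>n. diffs ?a n * z ^ n) sums ?D" by (rule summable_sums)
  from sums_mult[OF this, of z]
  have D: "(\<lambda>n. (real n + 1) * ?a (Suc n) * z ^ Suc n) sums (z * ?D)"
    by (simp add: diffs_def algebra_simps)
  \<comment> \<open>The term at index 0 vanishes because of the factor \<open>n\<close>, so shifting
    the index leaves the sum unchanged.\<close>
  then have D': "(\<lambda>n. real n * ?a n * z ^ n) sums (z * ?D)"
    using sums_Suc_iff[of "\<lambda>n. real n * ?a n * z ^ n" "z * ?D"] by (simp add: add.commute)
  have H: "(\<lambda>n. ?a n * z ^ n) sums ?H" by (rule inverse_catalan_gf_sums[OF assms])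
  then have H': "(\<lambda>n. ?a (Suc n) * z ^ Suc n) sums (?H - 1)"
    using sums_Suc_iff[of "\<lambda>n. ?a n * z ^ n" "?H - 1"] by (simp add: catalan_def)
  \<comment> \<open>Splits \<open>4 * n + 2\<close> as \<open>4 * (n + 1) - 2\<close>, matching the
    shifted series for \<open>z * H'\<close> and \<open>H - 1\<close>.\<close>
  have 1: "(\<lambda>n. (4 * real n + 2) * ?a (Suc n) * z ^ Suc n) sums (4 * (z * ?D) - 2 * (?H - 1))"
    using sums_diff[OF sums_mult[OF D, of 4] sums_mult[OF H', of 2]]
    by (rule back_subst[of "\<lambda>f. f sums _"]) (auto simp: fun_eq_iff algebra_simps add_divide_distrib)
  have 2: "(\<lambda>n. (real n + 2) * ?a n * z ^ Suc n) sums (z * (z * ?D + 2 * ?H))"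
    using sums_mult[OF sums_add[OF D' sums_mult[OF H, of 2]], of z]
    by (rule back_subst[of "\<lambda>f. f sums _"]) (auto simp: fun_eq_iff algebra_simps add_divide_distrib)
  have "4 * (z * ?D) - 2 * (?H - 1) = z * (z * ?D + 2 * ?H)"
    using 1 2 unfolding inverse_catalan_Suc by (rule sums_unique2)
  then show "z * (4 - z) * ?D = (2 + 2 * z) * ?H - 2"
    by (simp add: algebra_simps)
qed

section \<open>Closed form of the generating function\<close>

lemma inverse_catalan_gf_sin:
  assumes t: "0 < t" "t < pi / 2"
  shows "inverse_catalan_gf (4 * (sin t)\<^sup>2)
    = ((sin t)\<^sup>2 + 2) / (2 * cos t ^ 4) + 3 * t * sin t / (2 * cos t ^ 5)"
proof -
  \<comment> \<open>In the variable \<open>t\<close> the homogeneous equation is solved by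
    \<open>sin t / cos t ^ 5\<close>, so \<open>H * cos t ^ 5 / sin t\<close> has derivative
    \<open>- cos t ^ 4 / (sin t)\<^sup>2\<close>. An antiderivative of the latter is
    \<open>cot t + 3 * t / 2 + sin t * cos t / 2\<close>; \<open>f\<close> is the difference of the
    two, times \<open>sin\<close>.\<close>
  define f where "f x = inverse_catalan_gf (4 * (sin x)\<^sup>2) * cos x ^ 5
      - ((sin x)\<^sup>2 + 2) * cos x / 2 - 3 / 2 * x * sin x" for x
  \<comment> \<open>The equation says that \<open>f / sin\<close> has derivative zero where
    \<open>sin\<close> does not vanish. At 0 it does not determine \<open>d\<close>, so that value
    is recorded separately.\<close>
  have deriv: "\<exists>d. (f has_real_derivative d) (at x) \<and> sin x * d = cos x * f x \<and> (x = 0 \<longrightarrow> d = 0)"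
    if x: "x \<in> {- pi / 2<..<pi / 2}" for x
  proof -
    have c: "cos x > 0" using x by (intro cos_gt_zero_pi) auto
    then have "(cos x)\<^sup>2 > 0" by simp
    then have lt: "(sin x)\<^sup>2 < 1" using sin_squared_eq[of x] by linarith
    then have z: "\<bar>4 * (sin x)\<^sup>2\<bar> < 4" by simp
    obtain D where D: "(inverse_catalan_gf has_real_derivative D) (at (4 * (sin x)\<^sup>2))"
      and ode: "4 * (sin x)\<^sup>2 * (4 - 4 * (sin x)\<^sup>2) * D
        = (2 + 2 * (4 * (sin x)\<^sup>2)) * inverse_catalan_gf (4 * (sin x)\<^sup>2) - 2"
      using inverse_catalan_gf_ode[OF z] .
    define H where "H = inverse_catalan_gf (4 * (sin x)\<^sup>2)"
    define d where "d = D * (8 * sin x * cos x) * cos x ^ 5 - H * (5 * cos x ^ 4 * sin x)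
        - (2 * sin x * cos x * cos x - ((sin x)\<^sup>2 + 2) * sin x) / 2
        - 3 / 2 * sin x - 3 / 2 * x * cos x"
    have "((\<lambda>x. inverse_catalan_gf (4 * (sin x)\<^sup>2)) has_real_derivative D * (8 * sin x * cos x)) (at x)"
      by (rule DERIV_chain2[where f = inverse_catalan_gf and g = "\<lambda>x. 4 * (sin x)\<^sup>2", OF D]) (auto intro!: derivative_eq_intros)
    then have "(f has_real_derivative d) (at x)"
      unfolding f_def[abs_def] d_def H_def
      by (auto intro!: derivative_eq_intros simp: field_simps power2_eq_square)
    moreover have "sin x * d = cos x * f x"
    proof -
      have s: "(sin x)\<^sup>2 = 1 - (cos x)\<^sup>2" by (rule sin_squared_eq)
      have o: "4 * (sin x)\<^sup>2 * (4 * (cos x)\<^sup>2) * D = (2 + 8 * (sin x)\<^sup>2) * H - 2"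
        using ode unfolding H_def s by simp
      show ?thesis
        unfolding d_def f_def H_def[symmetric] using s o by algebra
    qed
    moreover have "x = 0 \<longrightarrow> d = 0" by (simp add: d_def)
    ultimately show ?thesis by blast
  qed
  have "f t = 0"
  proof -
    have const: "f x / sin x = f t / sin t" if "x \<in> {0<..<pi / 2}" for x
    proof (rule DERIV_isconst3[where f = "\<lambda>x. f x / sin x" and a = 0 and b = "pi / 2"])
      fix y assume y: "y \<in> {0<..<pi / 2}"
      then have s: "sin y > 0" by (intro sin_gt_zero) auto
      obtain d where d: "(f has_real_derivative d) (at y)" "sin y * d = cos y * f y"
        using deriv[of y] y by auto
      show "((\<lambda>x. f x / sin x) has_real_derivative 0) (at y)"
        using s d by (auto intro!: derivative_eq_intros simp: field_simps)
    qed (use t that in auto)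
    \<comment> \<open>The constant is found by letting \<open>x\<close> tend to 0 from the right:
      \<open>f x / x\<close> tends to \<open>f'(0) = 0\<close>, but it also equals
      \<open>f t / sin t * (sin x / x)\<close>, which tends to \<open>f t / sin t\<close>.\<close>
    have "(f has_real_derivative 0) (at 0)" using deriv[of 0] by force
    then have "(\<lambda>x. f x / x) \<midarrow>0\<rightarrow> 0"
      by (simp add: has_field_derivative_iff f_def inverse_catalan_gf_0)
    then have lim0: "((\<lambda>x. f x / x) \<longlongrightarrow> 0) (at_right 0)"
      by (rule tendsto_mono[OF at_le[OF subset_UNIV]])
    have "(\<lambda>x::real. sin x / x) \<midarrow>0\<rightarrow> 1"
      using DERIV_sin[of "0::real"] by (simp add: has_field_derivative_iff)
    then have "((\<lambda>x::real. sin x / x) \<longlongrightarrow> 1) (at_right 0)"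
      by (rule tendsto_mono[OF at_le[OF subset_UNIV]])
    then have "((\<lambda>x. f t / sin t * (sin x / x)) \<longlongrightarrow> f t / sin t * 1) (at_right 0)"
      by (rule tendsto_mult_left)
    moreover have "eventually (\<lambda>x. f t / sin t * (sin x / x) = f x / x) (at_right 0)"
    proof -
      have "eventually (\<lambda>x. x \<in> {0<..<pi / 2}) (at_right (0::real))"
        by (rule eventually_at_right_real) simp
      then show ?thesis
      proof eventually_elim
        case (elim x)
        then have "sin x > 0" by (intro sin_gt_zero) auto
        then show ?case unfolding const[OF elim, symmetric] by simp
      qed
    qed
    ultimately have "((\<lambda>x. f x / x) \<longlongrightarrow> f t / sin t * 1) (at_right 0)"
      by (rule Lim_transform_eventually)
    with lim0 have "f t / sin t * 1 = 0"
      using tendsto_unique[OF trivial_limit_at_right_real] by blast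
    moreover have "sin t > 0" using t by (intro sin_gt_zero) auto
    ultimately show ?thesis by simp
  qed
  moreover have "cos t > 0" using t by (intro cos_gt_zero_pi) auto
  ultimately show ?thesis
    unfolding f_def by (simp add: divide_simps) algebra
qed

section \<open>The golden ratio and the angles \<open>pi / 10\<close> and
  \<open>3 * pi / 10\<close>\<close>

lemma alpha_square: "\<alpha>\<^sup>2 = \<alpha> + 1" and beta_square: "\<beta>\<^sup>2 = \<beta> + 1"
  by (simp_all add: \<alpha>_def \<beta>_def power2_eq_square field_simps)

text \<open>These reduce identities in \<alpha>, \<beta> and \<open>sqrt 5\<close> to polynomial
  identities modulo \<open>\<alpha>\<^sup>2 - \<alpha> - 1\<close>.\<close>

lemma sqrt5_alpha: "sqrt 5 = 2 * \<alpha> - 1" and beta_alpha: "\<beta> = 1 - \<alpha>"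
  by (simp_all add: \<alpha>_def \<beta>_def field_simps)

lemma alpha_gt_1: "\<alpha> > 1"
  by (simp add: \<alpha>_def)

text \<open>Twice and three times the angle are complementary. Cancelling the cosine in
  \<open>sin (2 * t) = cos (3 * t)\<close> leaves a quadratic for \<open>2 * sin t\<close> with
  roots \<open>- \<alpha>\<close> and \<open>- \<beta>\<close>, of which only the second is
  positive.\<close>

lemma sin_pi_10: "sin (pi / 10) = - \<beta> / 2"
proof -
  let ?t = "pi / 10"
  have c: "cos ?t > 0" by (intro cos_gt_zero_pi) auto
  have s: "sin ?t > 0" by (intro sin_gt_zero) auto
  have "sin (2 * ?t) = cos (3 * ?t)"
    by (simp add: sin_cos_eq field_simps)
  then have "2 * sin ?t * cos ?t = 4 * cos ?t ^ 3 - 3 * cos ?t"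
    by (simp only: sin_double cos_treble_cos)
  then have "cos ?t * (2 * sin ?t) = cos ?t * (4 * (cos ?t)\<^sup>2 - 3)"
    by (simp add: algebra_simps power2_eq_square power3_eq_cube)
  then have "2 * sin ?t = 4 * (cos ?t)\<^sup>2 - 3"
    using c by simp
  then have "4 * (sin ?t)\<^sup>2 + 2 * sin ?t = 1"
    by (simp add: cos_squared_eq)
  then have "(2 * sin ?t + \<beta>) * (2 * sin ?t + \<alpha>) = 0"
    using alpha_square beta_alpha by algebra
  moreover have "2 * sin ?t + \<alpha> > 0" using s alpha_gt_1 by linarith
  ultimately show ?thesis by simp
qed

lemma sin_3_pi_10: "sin (3 * pi / 10) = \<alpha> / 2"
proof -
  have "sin (3 * x) = 3 * sin x - 4 * sin x ^ 3" for x :: real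
  proof -
    have "sin (x + 2 * x) = sin x * ((cos x)\<^sup>2 - (sin x)\<^sup>2) + cos x * (2 * sin x * cos x)"
      unfolding sin_add[of x "2 * x"] sin_double cos_double ..
    then show ?thesis using sin_squared_eq[of x] by simp algebra
  qed
  then have "sin (3 * (pi / 10)) = 3 * sin (pi / 10) - 4 * sin (pi / 10) ^ 3" .
  also have "\<dots> = \<alpha> / 2"
    unfolding sin_pi_10 using alpha_square beta_alpha by algebra
  finally show ?thesis by simp
qed

text \<open>Ties the cosine to the radical of the final formula, so that an odd power of the cosine
  can be traded for that radical. Both sides are nonnegative, so squares are compared.\<close>

lemma cos_pi_10: "2 * cos (pi / 10) * sqrt (\<alpha> ^ 3 / sqrt 5) = \<alpha>\<^sup>2"
proof (rule power2_eq_imp_eq)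
  have "(cos (pi / 10))\<^sup>2 = 1 - \<beta>\<^sup>2 / 4"
    by (simp add: cos_squared_eq sin_pi_10 power_divide)
  moreover have "(sqrt (\<alpha> ^ 3 / sqrt 5))\<^sup>2 = \<alpha> ^ 3 / sqrt 5"
    using alpha_gt_1 by simp
  ultimately have "(2 * cos (pi / 10) * sqrt (\<alpha> ^ 3 / sqrt 5))\<^sup>2 = (4 - \<beta>\<^sup>2) * (\<alpha> ^ 3 / sqrt 5)"
    by (simp add: power_mult_distrib)
  also have "4 - \<beta>\<^sup>2 = \<alpha> * sqrt 5"
    using alpha_square beta_alpha sqrt5_alpha by algebra
  finally show "(2 * cos (pi / 10) * sqrt (\<alpha> ^ 3 / sqrt 5))\<^sup>2 = (\<alpha>\<^sup>2)\<^sup>2"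
    by (simp add: power2_eq_square power3_eq_cube)
next
  have "cos (pi / 10) > 0" by (intro cos_gt_zero_pi) auto
  then show "0 \<le> 2 * cos (pi / 10) * sqrt (\<alpha> ^ 3 / sqrt 5)"
    using alpha_gt_1 by simp
qed simp

lemma cos_3_pi_10: "2 * cos (3 * pi / 10) * sqrt (\<alpha> ^ 3 / sqrt 5) = \<alpha>"
proof (rule power2_eq_imp_eq)
  have "(cos (3 * pi / 10))\<^sup>2 = 1 - \<alpha>\<^sup>2 / 4"
    by (simp add: cos_squared_eq sin_3_pi_10 power_divide)
  moreover have "(sqrt (\<alpha> ^ 3 / sqrt 5))\<^sup>2 = \<alpha> ^ 3 / sqrt 5"
    using alpha_gt_1 by simp
  ultimately have "(2 * cos (3 * pi / 10) * sqrt (\<alpha> ^ 3 / sqrt 5))\<^sup>2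
      = (4 - \<alpha>\<^sup>2) * \<alpha> * (\<alpha>\<^sup>2 / sqrt 5)"
    by (simp add: power_mult_distrib) (simp add: power2_eq_square power3_eq_cube)
  also have "(4 - \<alpha>\<^sup>2) * \<alpha> = sqrt 5"
    using alpha_square sqrt5_alpha by algebra
  finally show "(2 * cos (3 * pi / 10) * sqrt (\<alpha> ^ 3 / sqrt 5))\<^sup>2 = \<alpha>\<^sup>2"
    by simp
next
  have "cos (3 * pi / 10) > 0" by (intro cos_gt_zero_pi) auto
  then show "0 \<le> 2 * cos (3 * pi / 10) * sqrt (\<alpha> ^ 3 / sqrt 5)"
    using alpha_gt_1 by simp
qed (use alpha_gt_1 in simp)

section \<open>Values of the generating function at \<open>\<alpha>\<^sup>2\<close> and
  \<open>\<beta>\<^sup>2\<close>\<close>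

lemma inverse_catalan_gf_alpha:
  "inverse_catalan_gf (\<alpha>\<^sup>2) = 2 / 5 * (\<alpha> ^ 4 + 8 * \<alpha>\<^sup>2)
    + (\<alpha> ^ 3 * sqrt 5 - \<alpha>) * (12 * pi / 25) * sqrt (\<alpha> ^ 3 / sqrt 5)"
proof -
  define t where "t = 3 * pi / 10"
  define R where "R = sqrt (\<alpha> ^ 3 / sqrt 5)"
  have c: "cos t > 0" unfolding t_def by (intro cos_gt_zero_pi) auto
  have s: "sin t = \<alpha> / 2" unfolding t_def by (rule sin_3_pi_10)
  have cR: "2 * cos t * R = \<alpha>" unfolding t_def R_def by (rule cos_3_pi_10)
  \<comment> \<open>Here \<open>(4 - \<alpha>\<^sup>2)\<^sup>2 = 5 * (2 - \<alpha>) = 5 /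
    \<alpha>\<^sup>2\<close>, so the reciprocal of \<open>cos t ^ 4\<close> is a polynomial in
    \<alpha>.\<close>
  have c4: "16 * cos t ^ 4 * \<alpha>\<^sup>2 = 5"
  proof -
    have "4 * (cos t)\<^sup>2 = 4 - \<alpha>\<^sup>2" by (simp add: cos_squared_eq s power_divide)
    then show ?thesis using alpha_square by algebra
  qed
  have "32 * \<alpha> * R * cos t ^ 5 = 16 * cos t ^ 4 * \<alpha> * (2 * cos t * R)"
    by algebra
  also have "\<dots> = 5"
    using c4 unfolding cR by (simp add: power2_eq_square)
  finally have "1 / cos t ^ 5 = 32 / 5 * \<alpha> * R"
    using c by (simp add: field_simps)
  moreover have "1 / cos t ^ 4 = 16 / 5 * \<alpha>\<^sup>2"
    using c c4 by (simp add: field_simps)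
  moreover have "inverse_catalan_gf (\<alpha>\<^sup>2)
      = (\<alpha>\<^sup>2 / 4 + 2) / 2 * (1 / cos t ^ 4) + 3 * t * \<alpha> / 4 * (1 / cos t ^ 5)"
    using inverse_catalan_gf_sin[of t] unfolding s by (simp add: t_def power_divide)
  ultimately have "inverse_catalan_gf (\<alpha>\<^sup>2)
      = (\<alpha>\<^sup>2 / 4 + 2) / 2 * (16 / 5 * \<alpha>\<^sup>2) + 3 * t * \<alpha> / 4 * (32 / 5 * \<alpha> * R)"
    by (simp only:)
  also have "\<dots> = 2 / 5 * (\<alpha> ^ 4 + 8 * \<alpha>\<^sup>2) + 3 * \<alpha>\<^sup>2 * (12 * pi / 25) * R"
    unfolding t_def by (simp add: field_simps power_numeral_reduce)
  \<comment> \<open>The longer form is the one shared with \<beta>, with the same sign of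
    \<open>sqrt 5\<close>; only then can the two values be combined into Fibonacci and Lucas
    numbers.\<close>
  also have "3 * \<alpha>\<^sup>2 = \<alpha> ^ 3 * sqrt 5 - \<alpha>"
    using alpha_square sqrt5_alpha by algebra
  finally show ?thesis unfolding R_def .
qed

lemma inverse_catalan_gf_beta:
  "inverse_catalan_gf (\<beta>\<^sup>2) = 2 / 5 * (\<beta> ^ 4 + 8 * \<beta>\<^sup>2)
    + (\<beta> ^ 3 * sqrt 5 - \<beta>) * (12 * pi / 25) * sqrt (\<alpha> ^ 3 / sqrt 5)"
proof -
  define t where "t = pi / 10"
  define R where "R = sqrt (\<alpha> ^ 3 / sqrt 5)"
  have c: "cos t > 0" unfolding t_def by (intro cos_gt_zero_pi) auto
  have s: "sin t = - \<beta> / 2" unfolding t_def by (rule sin_pi_10)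
  have ab: "\<alpha> * \<beta> = - 1" using alpha_square beta_alpha by algebra
  have "2 * cos t * R = \<alpha>\<^sup>2" unfolding t_def R_def by (rule cos_pi_10)
  then have cR: "2 * cos t * R * \<beta>\<^sup>2 = 1" using ab by algebra
  have c4: "16 * cos t ^ 4 * \<beta>\<^sup>2 = 5"
  proof -
    have "4 * (cos t)\<^sup>2 = 4 - \<beta>\<^sup>2" by (simp add: cos_squared_eq s power_divide)
    then show ?thesis using beta_square by algebra
  qed
  have "1 / cos t ^ 4 = 16 / 5 * \<beta>\<^sup>2"
    using c c4 by (simp add: field_simps)
  moreover have "32 * \<beta> ^ 4 * R * cos t ^ 5 = (16 * cos t ^ 4 * \<beta>\<^sup>2) * (2 * cos t * R * \<beta>\<^sup>2)"
    by algebra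
  then have "32 * \<beta> ^ 4 * R * cos t ^ 5 = 5"
    unfolding c4 cR by simp
  then have "1 / cos t ^ 5 = 32 / 5 * \<beta> ^ 4 * R"
    using c by (simp add: field_simps)
  \<comment> \<open>The minus sign comes from \<open>sin t = - \<beta> / 2\<close>, as \<beta> is
    negative.\<close>
  moreover have "inverse_catalan_gf (\<beta>\<^sup>2)
      = (\<beta>\<^sup>2 / 4 + 2) / 2 * (1 / cos t ^ 4) - 3 * t * \<beta> / 4 * (1 / cos t ^ 5)"
    using inverse_catalan_gf_sin[of t] unfolding s by (simp add: t_def power_divide)
  ultimately have "inverse_catalan_gf (\<beta>\<^sup>2)
      = (\<beta>\<^sup>2 / 4 + 2) / 2 * (16 / 5 * \<beta>\<^sup>2) - 3 * t * \<beta> / 4 * (32 / 5 * \<beta> ^ 4 * R)"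
    by (simp only:)
  also have "\<dots> = 2 / 5 * (\<beta> ^ 4 + 8 * \<beta>\<^sup>2) + - (\<beta> ^ 5) * (12 * pi / 25) * R"
    unfolding t_def by (simp add: field_simps power_numeral_reduce)
  also have "- (\<beta> ^ 5) = \<beta> ^ 3 * sqrt 5 - \<beta>"
    using beta_square beta_alpha sqrt5_alpha by algebra
  finally show ?thesis unfolding R_def .
qed

text \<open>Scaling by \<open>x powi s\<close> shifts all exponents by \<open>s\<close>; since
  \<open>s\<close> may be negative, splitting the powers relies on \<open>x \<noteq> 0\<close>. The
  factors \<open>k\<close> and \<open>l\<close> stand for \<open>12 * pi / 25\<close> and the
  radical.\<close>

lemma sums_power_int_catalan:
  fixes x k :: real
  assumes "x \<noteq> 0" "x\<^sup>2 < 4"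
    and gf: "inverse_catalan_gf (x\<^sup>2) = 2 / 5 * (x ^ 4 + 8 * x\<^sup>2) + (x ^ 3 * sqrt 5 - x) * k * l"
  shows "(\<lambda>n. x powi (2 * int n + s) / catalan n) sums
    (2 / 5 * (x powi (s + 4) + 8 * x powi (s + 2)) + (x powi (s + 3) * sqrt 5 - x powi (s + 1)) * k * l)"
proof -
  have p: "x powi (2 * int n + s) / catalan n = x powi s * (1 / catalan n * (x\<^sup>2) ^ n)" for n
  proof -
    have "x powi (2 * int n) = (x\<^sup>2) ^ n"
      using power_int_of_nat[of x "2 * n"] by (simp add: power_mult)
    then show ?thesis using assms(1) by (simp add: power_int_add)
  qed
  have e: "x powi (s + numeral m) = x powi s * x ^ numeral m" "x powi (s + 1) = x powi s * x" for m
    using assms(1) by (simp_all add: power_int_add)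
  have "(\<lambda>n. x powi s * (1 / catalan n * (x\<^sup>2) ^ n)) sums (x powi s * inverse_catalan_gf (x\<^sup>2))"
    using assms(2) by (intro sums_mult inverse_catalan_gf_sums) simp
  then show ?thesis
    unfolding p gf e by (simp add: algebra_simps)
qed

theorem theorem3:
  fixes s :: int
  shows "((\<lambda>n. fibonacci (2 * int n + s) / catalan n) sums
            (2 / 5 * (fibonacci (s + 4) + 8 * fibonacci (s + 2))
             + (fibonacci (s + 3) * sqrt 5 - fibonacci (s + 1))
               * (12 * pi / 25) * sqrt (\<alpha> ^ 3 / sqrt 5)))
       \<and> ((\<lambda>n. lucas (2 * int n + s) / catalan n) sums
            (2 / 5 * (lucas (s + 4) + 8 * lucas (s + 2))
             + (lucas (s + 3) * sqrt 5 - lucas (s + 1))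
               * (12 * pi / 25) * sqrt (\<alpha> ^ 3 / sqrt 5)))"
proof -
  have "sqrt 5 < sqrt 9" by (subst real_sqrt_less_iff) simp
  then have s5: "sqrt 5 < 3" by simp
  have A: "\<alpha> \<noteq> 0" "\<alpha>\<^sup>2 < 4"
    using alpha_gt_1 s5 unfolding alpha_square sqrt5_alpha by auto
  have B: "\<beta> \<noteq> 0" "\<beta>\<^sup>2 < 4"
    using alpha_gt_1 s5 unfolding beta_square sqrt5_alpha unfolding beta_alpha by auto
  note a = sums_power_int_catalan[OF A inverse_catalan_gf_alpha, of s]
  note b = sums_power_int_catalan[OF B inverse_catalan_gf_beta, of s]
  show ?thesis
  proof
    show "(\<lambda>n. fibonacci (2 * int n + s) / catalan n) sums
            (2 / 5 * (fibonacci (s + 4) + 8 * fibonacci (s + 2))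
             + (fibonacci (s + 3) * sqrt 5 - fibonacci (s + 1))
               * (12 * pi / 25) * sqrt (\<alpha> ^ 3 / sqrt 5))"
      \<comment> \<open>Both sums are the same linear expression in integer powers of \<alpha> and
        of \<beta>, so the Binet combination passes through term by term.\<close>
      using sums_divide[OF sums_diff[OF a b], of "\<alpha> - \<beta>"]
      unfolding fibonacci_def by (simp add: diff_divide_distrib add_divide_distrib algebra_simps)
    show "(\<lambda>n. lucas (2 * int n + s) / catalan n) sums
            (2 / 5 * (lucas (s + 4) + 8 * lucas (s + 2))
             + (lucas (s + 3) * sqrt 5 - lucas (s + 1))
               * (12 * pi / 25) * sqrt (\<alpha> ^ 3 / sqrt 5))"
      using sums_add[OF a b]
      unfolding lucas_def by (simp add: add_divide_distrib algebra_simps)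
  qed
qed

end
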